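(* Let $\mathcal{L}$ be a non-translation-invariant homogeneous linear equation. Then there exists $\lambda=\lambda(\mathcal{L})>0$ such that every finite set $Z\subseteq\mathbb{Z}\setminus\{0\}$ contains an $\mathcal{L}$-free subset of size more than $\lambda|Z|$.
   Context: A homogeneous non-translation-invariant linear equation is one of the form $a_1x_1+\dots+a_kx_k=b_1y_1+\dots+b_\ell y_\ell$ with fixed $a_i,b_j\in\mathbb{N}$ and $a_1+\dots+a_k\neq b_1+\dots+b_\ell$. A solution is trivial if there is a partition of the variable positions into classes such that entries in the same class are equal and, writing the equation as $\sum a_ix_i-\sum b_jy_j=0$, the coefficients in each class sum to $0$. A set of integers is $\mathcal{L}$-free if it contains no non-trivial solution of $\mathcal{L}$. *)

theory Defs
  imports Complex_Main "HOL-Library.Disjoint_Sets"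
begin

text \<open>
  A pair of lists \<open>a\<close>, \<open>b\<close> encodes the equation
  \<open>a\<^sub>1 x\<^sub>1 + \<dots> + a\<^sub>k x\<^sub>k = b\<^sub>1 y\<^sub>1 + \<dots> + b\<^sub>l y\<^sub>l\<close>, where \<open>k, l \<ge> 1\<close>
  and the coefficients are positive integers.
\<close>

definition hom_lin_eq :: "nat list \<Rightarrow> nat list \<Rightarrow> bool" where
  "hom_lin_eq a b \<longleftrightarrow> a \<noteq> [] \<and> b \<noteq> [] \<and> (\<forall>c \<in> set a \<union> set b. 0 < c)"

definition translation_invariant :: "nat list \<Rightarrow> nat list \<Rightarrow> bool" where
  "translation_invariant a b \<longleftrightarrow> sum_list a = sum_list b"

definition is_solution :: "nat list \<Rightarrow> nat list \<Rightarrow> int list \<Rightarrow> int list \<Rightarrow> bool" where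
  "is_solution a b x y \<longleftrightarrow>
     length x = length a \<and> length y = length b \<and>
     (\<Sum>i<length a. int (a ! i) * x ! i) = (\<Sum>j<length b. int (b ! j) * y ! j)"

text \<open>
  Coefficients after moving everything to the left-hand side. Variable positions are the
  indices of this list, so position \<open>i\<close> carries the entry \<open>(x @ y) ! i\<close>.
\<close>

definition signed_coeffs :: "nat list \<Rightarrow> nat list \<Rightarrow> int list" where
  "signed_coeffs a b = map int a @ map (\<lambda>c. - int c) b"

definition trivial_solution :: "nat list \<Rightarrow> nat list \<Rightarrow> int list \<Rightarrow> int list \<Rightarrow> bool" where
  "trivial_solution a b x y \<longleftrightarrow>
     is_solution a b x y \<and>
     (\<exists>P. partition_on {..<length a + length b} P \<and>
          (\<forall>C\<in>P. (\<forall>i\<in>C. \<forall>j\<in>C. (x @ y) ! i = (x @ y) ! j) \<and>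
                 (\<Sum>i\<in>C. signed_coeffs a b ! i) = 0))"

definition equation_free :: "nat list \<Rightarrow> nat list \<Rightarrow> int set \<Rightarrow> bool" where
  "equation_free a b A \<longleftrightarrow>
     \<not> (\<exists>x y. set x \<subseteq> A \<and> set y \<subseteq> A \<and> is_solution a b x y \<and> \<not> trivial_solution a b x y)"

end

theory Submission
  imports Defs "HOL-Number_Theory.Cong"
begin

text \<open>
  Erdos' dilation argument. Let \<open>S\<close> and \<open>T\<close> be the two coefficient sums and \<open>D = \<bar>S - T\<bar>\<close>.
  If all residues \<open>t * z mod p\<close> lie in a short interval starting near \<open>p / (2 * D)\<close>, then
  the two sides of the equation, dilated by \<open>t\<close>, differ by about \<open>p / 2\<close> modulo \<open>p\<close>, so there is
  no solution at all. For a large prime \<open>p\<close>, an average over all \<open>t\<close> yields one for which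
  a positive proportion of \<open>Z\<close> is dilated into that interval.
\<close>

lemma weighted_sum_bounds:
  fixes c :: "nat list" and r :: "nat \<Rightarrow> int"
  assumes "\<And>i. i < length c \<Longrightarrow> l \<le> r i" "\<And>i. i < length c \<Longrightarrow> r i \<le> u"
  shows "int (sum_list c) * l \<le> (\<Sum>i<length c. int (c ! i) * r i)"
    and "(\<Sum>i<length c. int (c ! i) * r i) \<le> int (sum_list c) * u"
proof -
  have eq: "int (sum_list c) * v = (\<Sum>i<length c. int (c ! i) * v)" for v
    by (simp add: sum_list_sum_nth atLeast0LessThan sum_distrib_right)
  show "int (sum_list c) * l \<le> (\<Sum>i<length c. int (c ! i) * r i)"
    unfolding eq by (intro sum_mono mult_left_mono) (use assms in auto)
  show "(\<Sum>i<length c. int (c ! i) * r i) \<le> int (sum_list c) * u"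
    unfolding eq by (intro sum_mono mult_left_mono) (use assms in auto)
qed

text \<open>Replacing each entry by its dilated residue preserves both sides up to multiples of
  \<open>p\<close>, so a solution makes the residue sums \<open>L\<close> and \<open>R\<close>
  congruent mod \<open>p\<close>. But \<open>\<bar>L - R\<bar>\<close> is within
  \<open>N * w\<close> of \<open>D * m\<close>, hence strictly between \<open>0\<close> and
  \<open>p\<close>.\<close>

lemma equation_free_if_dilate_in_interval:
  fixes a b :: "nat list" and p t m w :: int
  defines "D \<equiv> \<bar>int (sum_list a) - int (sum_list b)\<bar>"
    and "N \<equiv> int (sum_list a) + int (sum_list b)"
  assumes interval: "\<And>z. z \<in> A \<Longrightarrow> t * z mod p \<in> {m..m + w}"
    and w: "0 \<le> w" and lower: "N * w < D * m" and upper: "D * m + N * w < p"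
  shows "equation_free a b A"
  unfolding equation_free_def
proof
  assume "\<exists>x y. set x \<subseteq> A \<and> set y \<subseteq> A \<and> is_solution a b x y \<and> \<not> trivial_solution a b x y"
  then obtain x y where A: "set x \<subseteq> A" "set y \<subseteq> A" and sol: "is_solution a b x y"
    by blast
  define L where "L = (\<Sum>i<length a. int (a ! i) * (t * x ! i mod p))"
  define R where "R = (\<Sum>j<length b. int (b ! j) * (t * y ! j mod p))"
  have len: "length x = length a" "length y = length b"
    using sol by (auto simp: is_solution_def)
  have dilate: "[(\<Sum>i<n. int (c ! i) * (t * v ! i mod p)) = t * (\<Sum>i<n. int (c ! i) * v ! i)] (mod p)"
    for n and c :: "nat list" and v :: "int list"
  proof -
    have "[int (c ! i) * (t * v ! i mod p) = t * (int (c ! i) * v ! i)] (mod p)" for i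
      by (simp add: cong_def mod_mult_right_eq mult.left_commute)
    then show ?thesis
      unfolding sum_distrib_left by (intro cong_sum)
  qed
  have "[L = R] (mod p)"
    using dilate[where n="length a" and c=a and v=x] dilate[where n="length b" and c=b and v=y] sol
    unfolding L_def R_def is_solution_def cong_def by simp
  then have dvd: "p dvd L - R"
    by (simp add: cong_iff_dvd_diff)
  have "x ! i \<in> A" if "i < length a" for i
    using A len that by (metis nth_mem subsetD)
  then have L: "int (sum_list a) * m \<le> L" "L \<le> int (sum_list a) * (m + w)"
    unfolding L_def using interval
    by (auto intro!: weighted_sum_bounds)
  have "y ! i \<in> A" if "i < length b" for i
    using A len that by (metis nth_mem subsetD)
  then have R: "int (sum_list b) * m \<le> R" "R \<le> int (sum_list b) * (m + w)"
    unfolding R_def using interval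
    by (auto intro!: weighted_sum_bounds)
  have nonneg: "0 \<le> int (sum_list a) * w" "0 \<le> int (sum_list b) * w"
    using w by simp_all
  have "0 < \<bar>L - R\<bar> \<and> \<bar>L - R\<bar> < p"
  \<comment> \<open>Fixing the sign inside \<open>D\<close> turns the claim into a linear one in the
    products such as \<open>int (sum_list a) * m\<close>.\<close>
  proof (cases "sum_list b \<le> sum_list a")
    case True
    then have "D * m = int (sum_list a) * m - int (sum_list b) * m"
      by (simp add: D_def left_diff_distrib)
    then show ?thesis
      using L R lower upper nonneg unfolding N_def distrib_left distrib_right by linarith
  next
    case False
    then have "D * m = int (sum_list b) * m - int (sum_list a) * m"
      by (simp add: D_def left_diff_distrib)
    then show ?thesis
      using L R lower upper nonneg unfolding N_def distrib_left distrib_right by linarith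
  qed
  with dvd show False
    using zdvd_imp_le[of p "\<bar>L - R\<bar>"] by simp
qed

lemma bij_betw_mult_mod_prime:
  fixes p z :: int
  assumes "prime p" "\<not> p dvd z"
  shows "bij_betw (\<lambda>t. t * z mod p) {0..<p} {0..<p}"
proof -
  have p: "0 < p"
    using assms(1) by (simp add: prime_gt_0_int)
  have "inj_on (\<lambda>t. t * z mod p) {0..<p}"
  proof (rule inj_onI)
    fix s t assume st: "s \<in> {0..<p}" "t \<in> {0..<p}" and "s * z mod p = t * z mod p"
    then have "[s * z = t * z] (mod p)"
      by (simp add: cong_def)
    moreover have "coprime z p"
      using assms by (simp add: prime_imp_coprime coprime_commute)
    ultimately have "[s = t] (mod p)"
      by (simp add: cong_mult_rcancel)
    with st show "s = t"
      by (simp add: cong_def)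
  qed
  moreover have "(\<lambda>t. t * z mod p) ` {0..<p} \<subseteq> {0..<p}"
    using p by auto
  ultimately show ?thesis
    by (simp add: bij_betw_def endo_inj_surj)
qed

text \<open>Double counting: each \<open>z\<close> is sent into \<open>I\<close> by exactly
  \<open>card I\<close> of the \<open>p\<close> multipliers, so the average over \<open>t\<close> of
  the number of \<open>z\<close> landing in \<open>I\<close> is \<open>card Z * card I / p\<close>,
  and some \<open>t\<close> attains at least the average.\<close>

lemma exists_popular_dilate:
  fixes p :: int and Z I :: "int set"
  assumes p: "prime p" and Z: "finite Z" "\<And>z. z \<in> Z \<Longrightarrow> \<not> p dvd z" and I: "I \<subseteq> {0..<p}"
  shows "\<exists>t. int (card Z) * int (card I) \<le> p * int (card {z \<in> Z. t * z mod p \<in> I})"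
proof (rule ccontr)
  define f where "f t = card {z \<in> Z. t * z mod p \<in> I}" for t
  assume "\<not> ?thesis"
  then have less: "p * int (f t) < int (card Z) * int (card I)" for t
    by (simp add: f_def not_le)
  have pos: "0 < p"
    using p by (simp add: prime_gt_0_int)
  have fibre: "card {t \<in> {0..<p}. t * z mod p \<in> I} = card I" if "z \<in> Z" for z
  proof -
    have bij: "bij_betw (\<lambda>t. t * z mod p) {0..<p} {0..<p}"
      using bij_betw_mult_mod_prime p Z(2) that by blast
    have "(\<lambda>t. t * z mod p) ` {t \<in> {0..<p}. t * z mod p \<in> I} = I"
    proof (intro subset_antisym subsetI)
      fix r assume "r \<in> I"
      moreover from this have "r \<in> (\<lambda>t. t * z mod p) ` {0..<p}"
        using bij_betw_imp_surj_on[OF bij] I by auto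
      ultimately show "r \<in> (\<lambda>t. t * z mod p) ` {t \<in> {0..<p}. t * z mod p \<in> I}"
        by auto
    qed auto
    then have "bij_betw (\<lambda>t. t * z mod p) {t \<in> {0..<p}. t * z mod p \<in> I} I"
      by (intro bij_betw_subset[OF bij]) auto
    then show ?thesis
      by (rule bij_betw_same_card)
  qed
  \<comment> \<open>Count the pairs \<open>(t, z)\<close> with \<open>t * z mod p \<in> I\<close> by
    \<open>t\<close> first, then by \<open>z\<close>.\<close>
  have "(\<Sum>t\<in>{0..<p}. f t) = (\<Sum>t\<in>{0..<p}. \<Sum>z\<in>Z. if t * z mod p \<in> I then 1 else 0)"
    unfolding f_def using Z(1) by (simp add: sum.If_cases Int_def)
  also have "\<dots> = (\<Sum>z\<in>Z. \<Sum>t\<in>{0..<p}. if t * z mod p \<in> I then 1 else 0)"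
    by (rule sum.swap)
  also have "\<dots> = (\<Sum>z\<in>Z. card {t \<in> {0..<p}. t * z mod p \<in> I})"
    by (simp add: sum.If_cases Int_def)
  also have "\<dots> = card Z * card I"
    using fibre by simp
  finally have total: "(\<Sum>t\<in>{0..<p}. f t) = card Z * card I" .
  have "(\<Sum>t\<in>{0..<p}. p * int (f t)) < (\<Sum>t\<in>{0..<p}. int (card Z) * int (card I))"
    using less pos by (intro sum_strict_mono) auto
  moreover have "(\<Sum>t\<in>{0..<p}. p * int (f t)) = p * (int (card Z) * int (card I))"
    using total by (simp flip: sum_distrib_left of_nat_sum of_nat_mult)
  ultimately show False
    using pos by simp
qed

theorem theorem4p3:
  fixes a b :: "nat list"
  assumes "hom_lin_eq a b"
    and "\<not> translation_invariant a b"
  shows "\<exists>lam::real. 0 < lam \<and>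
    (\<forall>Z::int set. finite Z \<and> Z \<noteq> {} \<and> Z \<subseteq> UNIV - {0} \<longrightarrow>
      (\<exists>A. A \<subseteq> Z \<and> equation_free a b A \<and> real (card A) > lam * real (card Z)))"
proof -
  define D where "D = \<bar>int (sum_list a) - int (sum_list b)\<bar>"
  define N where "N = int (sum_list a) + int (sum_list b)"
  \<comment> \<open>Non-translation-invariance enters here; it lets \<open>p\<close> be divided by
    \<open>2 * D\<close>.\<close>
  have D: "1 \<le> D"
    using assms(2) by (simp add: D_def translation_invariant_def)
  have N: "D \<le> N"
    by (simp add: D_def N_def)
  \<comment> \<open>The factor 4 gives \<open>N * w \<le> p / 4\<close> for
    \<open>w = p div K\<close>. The density \<open>1 / K\<close> depends only on the coefficients,
    while \<open>p\<close> may depend on \<open>Z\<close>.\<close>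
  define K where "K = 4 * N"
  have K: "0 < K"
    using D N by (simp add: K_def)
  have "\<exists>A. A \<subseteq> Z \<and> equation_free a b A \<and> real (card A) > 1 / real_of_int K * real (card Z)"
    if Z: "finite Z" "Z \<noteq> {}" "Z \<subseteq> UNIV - {0}" for Z :: "int set"
  proof -
    \<comment> \<open>The sum dominates every \<open>\<bar>z\<bar>\<close>, so \<open>p\<close>
      divides no element of \<open>Z\<close>; the term \<open>4 * D\<close> absorbs the rounding
      error in \<open>m\<close>.\<close>
    obtain q :: nat where q: "prime q" "nat (4 * D + (\<Sum>z\<in>Z. \<bar>z\<bar>)) < q"
      using bigger_prime by blast
    define p where "p = int q"
    have p: "prime p" "4 * D + (\<Sum>z\<in>Z. \<bar>z\<bar>) < p"
      using q by (auto simp: p_def)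
    have p4D: "4 * D < p"
    proof -
      have "0 \<le> (\<Sum>z\<in>Z. \<bar>z\<bar>)"
        by (simp add: sum_nonneg)
      with p(2) show ?thesis
        by linarith
    qed
    have ndvd: "\<not> p dvd z" if "z \<in> Z" for z
    proof
      assume "p dvd z"
      have "\<bar>z\<bar> < p"
        using member_le_sum[of z Z abs] that Z(1) p(2) D by simp
      moreover have "z \<noteq> 0"
        using Z that by auto
      ultimately show False
        using zdvd_imp_le[of p "\<bar>z\<bar>"] \<open>p dvd z\<close> by simp
    qed
    define m where "m = p div (2 * D)"
    define w where "w = p div K"
    have m: "2 * D * m \<le> p" "p < 2 * D * m + 2 * D"
      using D mult_div_mod_eq[of "2 * D" p] pos_mod_bound[of "2 * D" p] pos_mod_sign[of "2 * D" p]
      unfolding m_def by linarith+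
    have w: "K * w \<le> p" "p < K * w + K"
      using K mult_div_mod_eq[of K p] pos_mod_bound[of K p] pos_mod_sign[of K p]
      unfolding w_def by linarith+
    have nonneg: "0 \<le> m" "0 \<le> w"
      using D K p4D by (simp_all add: m_def w_def pos_imp_zdiv_nonneg_iff)
    \<comment> \<open>Rounding gives \<open>p / 2 - D < D * m \<le> p / 2\<close>, and
      \<open>D < p / 4\<close>, so \<open>N * w \<le> p / 4 < D * m\<close> and the sum is at most
      \<open>3 * p / 4\<close>.\<close>
    have lower: "N * w < D * m" and upper: "D * m + N * w < p"
      using m w(1) p4D D by (simp_all add: K_def)
    have "m \<le> D * m" "w \<le> N * w"
      using mult_right_mono[of 1 D m] mult_right_mono[of 1 N w] D N nonneg by simp_all
    then have I: "{m..m + w} \<subseteq> {0..<p}"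
      using nonneg upper by auto
    obtain t where t: "int (card Z) * int (card {m..m + w})
        \<le> p * int (card {z \<in> Z. t * z mod p \<in> {m..m + w}})"
      using exists_popular_dilate[OF p(1) Z(1) ndvd I] by blast
    define A where "A = {z \<in> Z. t * z mod p \<in> {m..m + w}}"
    have free: "equation_free a b A"
      using equation_free_if_dilate_in_interval[of A t p m w a b] nonneg lower upper
      by (simp add: A_def D_def N_def)
    have "0 < card Z"
      using Z by (simp add: card_gt_0_iff)
    \<comment> \<open>The interval has \<open>w + 1\<close> points, more than \<open>p / K\<close>
      despite the rounding in \<open>w\<close>; with \<open>Z\<close> nonempty this keeps the final
      bound strict.\<close>
    then have "int (card Z) * p < int (card Z) * (K * (w + 1))"
      using w(2) by (intro mult_strict_left_mono) (simp_all add: distrib_left)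
    also have "\<dots> = K * (int (card Z) * int (card {m..m + w}))"
      using nonneg by simp
    also have "\<dots> \<le> K * (p * int (card A))"
      using t K unfolding A_def by (intro mult_left_mono) auto
    finally have "p * int (card Z) < p * (K * int (card A))"
      by (simp add: algebra_simps)
    then have "int (card Z) < K * int (card A)"
      using p4D D by (simp add: mult_less_cancel_left_pos)
    then have "real (card Z) < real_of_int K * real (card A)"
      by (metis of_int_less_iff of_int_mult of_int_of_nat_eq)
    then have "1 / real_of_int K * real (card Z) < real (card A)"
      using K by (simp add: field_simps)
    with free show ?thesis
      by (intro exI[of _ A]) (auto simp: A_def)
  qed
  then show ?thesis
    using K by (intro exI[of _ "1 / real_of_int K"]) simp
qed

end
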